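(* The orbits of rowmotion on the comb $C_n$ can be partitioned into two sets $\mathcal{S}$ and $\mathcal{L}$ having the following properties. (a) $\#\mathcal{S}=2^{n-1}$, $\#\mathcal{L}=1$, and $$\#\mathcal{O}=\begin{cases}2&\text{if }\mathcal{O}\in\mathcal{S},\\2^{n+1}-1&\text{if }\mathcal{O}\in\mathcal{L}.\end{cases}$$ (b) $$\chi(\mathcal{O})=\begin{cases}n+1&\text{if }\mathcal{O}\in\mathcal{S},\\(2n+1)2^{n-1}&\text{if }\mathcal{O}\in\mathcal{L}.\end{cases}$$ Thus $\chi$ is homometric but not homomesic. (c) $$\hat\chi(\mathcal{O})=\begin{cases}3n+1&\text{if }\mathcal{O}\in\mathcal{S},\\2^{n-1}(6n-5)+3&\text{if }\mathcal{O}\in\mathcal{L}.\end{cases}$$ Thus $\hat\chi$ is homometric but not homomesic.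
   Context: For a finite poset $P$, let $\mathcal{A}(P)$ be its set of antichains, and for $Q\subseteq P$ let $Q{\downarrow}=\{x\in P: x\le y\text{ for some }y\in Q\}$. Rowmotion on antichains is the bijection $\rho(A)=\min\{x\in P: x\notin A{\downarrow}\}$ of $\mathcal{A}(P)$; rowmotion on lower order ideals is $\hat\rho(L)=\rho(\max L){\downarrow}$. The map $A\mapsto A{\downarrow}$ carries antichain orbits to ideal orbits. Orbits $\mathcal{O}$ are antichain orbits; $\chi(\mathcal{O})=\sum_{A\in\mathcal{O}}\#A$ and $\hat\chi(\mathcal{O})=\sum_{A\in\mathcal{O}}\#(A{\downarrow})$. A statistic $\mathrm{st}$ is homomesic if $\mathrm{st}(\mathcal{O})/\#\mathcal{O}$ is the same constant for all orbits $\mathcal{O}$, and homometric if $\mathrm{st}(\mathcal{O}_1)=\mathrm{st}(\mathcal{O}_2)$ for any two orbits with $\#\mathcal{O}_1=\#\mathcal{O}_2$. The comb $C_n$ ($n\ge1$) is the rooted tree (poset with unique minimal element whose Hasse diagram is a tree) on $2n+1$ elements: $n+1$ leaves (maximal elements) labeled $1,\dots,n+1$, and $n$ non-leaf elements $b_2,b_3,\dots,b_{n+1}$, where $b_m$ is the unique element whose set of leaves above it is $\{1,\dots,m\}$. Explicitly, $b_{n+1}<b_n<\dots<b_2$ is a chain with minimum the root $b_{n+1}$; for $3\le m\le n+1$ the element $b_m$ is covered by exactly $b_{m-1}$ and the leaf $m$; and $b_2$ is covered by exactly the leaves $1$ and $2$.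
   Formalization: The claim that χ is not homomesic is stated only for n ≥ 2, since it fails for n = 1: the two orbits on C_1 have sizes 3 and 2 with χ = 3 and 2, so both averages equal 1. *)

theory Defs
  imports Complex_Main "HOL-Combinatorics.Orbits"
begin

section \<open>Rowmotion on finite posets\<close>

text \<open>
  A poset is a carrier \<open>P\<close> together with a relation \<open>r\<close> such that
  \<^term>\<open>partial_order_on P r\<close>; \<open>(x, y) \<in> r\<close> means \<open>x \<le> y\<close>.
\<close>

definition antichains :: "'a set \<Rightarrow> 'a rel \<Rightarrow> 'a set set" where
  "antichains P r = {A. A \<subseteq> P \<and> (\<forall>x\<in>A. \<forall>y\<in>A. (x, y) \<in> r \<longrightarrow> x = y)}"

definition downset :: "'a set \<Rightarrow> 'a rel \<Rightarrow> 'a set \<Rightarrow> 'a set" where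
  "downset P r Q = {x \<in> P. \<exists>y\<in>Q. (x, y) \<in> r}"

definition minimals :: "'a rel \<Rightarrow> 'a set \<Rightarrow> 'a set" where
  "minimals r X = {x \<in> X. \<forall>y\<in>X. (y, x) \<in> r \<longrightarrow> y = x}"

definition rowmotion :: "'a set \<Rightarrow> 'a rel \<Rightarrow> 'a set \<Rightarrow> 'a set" where
  "rowmotion P r A = minimals r {x \<in> P. x \<notin> downset P r A}"

text \<open>
  \<^const>\<open>orbit\<close> only iterates forwards, and a strictly positive number of times. On a finite poset
  rowmotion permutes the antichains (\<open>bij_betw_rowmotion\<close> below), so this is the usual
  two-sided orbit and contains its starting point.
\<close>

definition rowmotion_orbits :: "'a set \<Rightarrow> 'a rel \<Rightarrow> 'a set set set" where
  "rowmotion_orbits P r = orbit (rowmotion P r) ` antichains P r"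

definition chi :: "'a set set \<Rightarrow> nat" where
  "chi X = (\<Sum>A\<in>X. card A)"

definition chi_hat :: "'a set \<Rightarrow> 'a rel \<Rightarrow> 'a set set \<Rightarrow> nat" where
  "chi_hat P r X = (\<Sum>A\<in>X. card (downset P r A))"

text \<open>In the next two definitions \<open>st\<close> is the statistic already summed over an orbit.\<close>

definition homomesic :: "'a set \<Rightarrow> 'a rel \<Rightarrow> ('a set set \<Rightarrow> nat) \<Rightarrow> bool" where
  "homomesic P r st \<longleftrightarrow> (\<exists>c::real. \<forall>X\<in>rowmotion_orbits P r. real (st X) / real (card X) = c)"

definition homometric :: "'a set \<Rightarrow> 'a rel \<Rightarrow> ('a set set \<Rightarrow> nat) \<Rightarrow> bool" where
  "homometric P r st \<longleftrightarrow>
    (\<forall>X\<in>rowmotion_orbits P r. \<forall>Y\<in>rowmotion_orbits P r. card X = card Y \<longrightarrow> st X = st Y)"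

lemma ex_minimal_below:
  assumes "finite X" "partial_order_on P r" "X \<subseteq> P" "x \<in> X"
  shows "\<exists>m\<in>minimals r X. (m, x) \<in> r"
  using assms(4)
proof (induction "card {y\<in>X. (y, x) \<in> r}" arbitrary: x rule: less_induct)
  case less
  have rf: "(x, x) \<in> r" and tr: "trans r" and as: "antisym r"
    using assms less.prems by (auto simp: partial_order_on_def preorder_on_def refl_on_def)
  show ?case
  proof (cases "x \<in> minimals r X")
    case True
    then show ?thesis using rf by blast
  next
    case False
    then obtain y where y: "y \<in> X" "(y, x) \<in> r" "y \<noteq> x"
      using less.prems by (auto simp: minimals_def)
    have "{z\<in>X. (z, y) \<in> r} \<subset> {z\<in>X. (z, x) \<in> r}"
    proof
      show "{z\<in>X. (z, y) \<in> r} \<subseteq> {z\<in>X. (z, x) \<in> r}"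
        using tr y by (auto dest: transD)
      have "(x, y) \<notin> r"
        using as y by (auto dest: antisymD)
      then show "{z\<in>X. (z, y) \<in> r} \<noteq> {z\<in>X. (z, x) \<in> r}"
        using less.prems rf by blast
    qed
    then have "card {z\<in>X. (z, y) \<in> r} < card {z\<in>X. (z, x) \<in> r}"
      using assms(1) by (intro psubset_card_mono) auto
    from less.hyps[OF this y(1)] show ?thesis
      using tr y by (auto dest: transD)
  qed
qed

lemma rowmotion_antichain: "rowmotion P r A \<in> antichains P r"
  unfolding rowmotion_def antichains_def minimals_def by blast

lemma bij_betw_rowmotion:
  assumes "finite P" "partial_order_on P r"
  shows "bij_betw (rowmotion P r) (antichains P r) (antichains P r)"
proof -
  have rf: "(x, x) \<in> r" if "x \<in> P" for x
    using assms that by (auto simp: partial_order_on_def preorder_on_def refl_on_def)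
  have tr: "trans r" and as: "antisym r" and sub: "r \<subseteq> P \<times> P"
    using assms by (auto simp: partial_order_on_def preorder_on_def)
  have up: "P - downset P r A = {x\<in>P. \<exists>m\<in>rowmotion P r A. (m, x) \<in> r}" for A
  proof (intro equalityI subsetI)
    fix x assume "x \<in> P - downset P r A"
    then show "x \<in> {x\<in>P. \<exists>m\<in>rowmotion P r A. (m, x) \<in> r}"
      using ex_minimal_below[of "{x \<in> P. x \<notin> downset P r A}" P r x] assms
      by (auto simp: rowmotion_def)
  next
    fix x assume "x \<in> {x\<in>P. \<exists>m\<in>rowmotion P r A. (m, x) \<in> r}"
    then obtain m where m: "x \<in> P" "m \<in> P" "m \<notin> downset P r A" "(m, x) \<in> r"
      by (auto simp: rowmotion_def minimals_def)
    then show "x \<in> P - downset P r A"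
      using tr by (auto simp: downset_def dest: transD)
  qed
  have "inj_on (rowmotion P r) (antichains P r)"
  proof (rule inj_onI)
    fix A B assume A: "A \<in> antichains P r" and B: "B \<in> antichains P r"
      and eq: "rowmotion P r A = rowmotion P r B"
    have "P - downset P r A = P - downset P r B"
      unfolding up eq ..
    moreover have "downset P r A \<subseteq> P" "downset P r B \<subseteq> P"
      by (auto simp: downset_def)
    ultimately have d: "downset P r A = downset P r B"
      by (metis double_diff order_refl)
    have le: "A \<subseteq> B" if "A \<in> antichains P r" "B \<in> antichains P r"
      and d: "downset P r A = downset P r B" for A B
    proof
      fix x assume x: "x \<in> A"
      then have xP: "x \<in> P" using that by (auto simp: antichains_def)
      then have "x \<in> downset P r A" using x rf by (auto simp: downset_def)
      then obtain y where y: "y \<in> B" "(x, y) \<in> r" using d by (auto simp: downset_def)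
      then have "y \<in> downset P r B" using that(2) rf by (auto simp: downset_def antichains_def)
      then obtain z where z: "z \<in> A" "(y, z) \<in> r" using d by (auto simp: downset_def)
      have "(x, z) \<in> r" using tr y z by (auto dest: transD)
      then have "x = z" using x z that(1) by (auto simp: antichains_def)
      then have "x = y" using as y z by (auto dest: antisymD)
      then show "x \<in> B" using y by simp
    qed
    from le[OF A B d] le[OF B A d[symmetric]] show "A = B" by blast
  qed
  moreover have "finite (antichains P r)"
    by (rule finite_subset[of _ "Pow P"]) (use assms in \<open>auto simp: antichains_def\<close>)
  ultimately show ?thesis
    by (metis bij_betw_def endo_inj_surj image_subsetI rowmotion_antichain)
qed


section \<open>The comb\<close>

text \<open>\<open>Leaf i\<close> is the leaf labelled \<open>i\<close>, and \<open>Spine m\<close> is the non-leaf element \<open>b\<^sub>m\<close>.\<close>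

datatype comb_elem = Leaf nat | Spine nat

definition comb :: "nat \<Rightarrow> comb_elem set" where
  "comb n = Leaf ` {1..n + 1} \<union> Spine ` {2..n + 1}"

inductive_set comb_covers :: "nat \<Rightarrow> comb_elem rel" for n :: nat where
  "3 \<le> m \<Longrightarrow> m \<le> n + 1 \<Longrightarrow> (Spine m, Spine (m - 1)) \<in> comb_covers n"
| "3 \<le> m \<Longrightarrow> m \<le> n + 1 \<Longrightarrow> (Spine m, Leaf m) \<in> comb_covers n"
| "n \<ge> 1 \<Longrightarrow> (Spine 2, Leaf 1) \<in> comb_covers n"
| "n \<ge> 1 \<Longrightarrow> (Spine 2, Leaf 2) \<in> comb_covers n"

text \<open>
  \<^term>\<open>(comb_covers n)\<^sup>*\<close> is reflexive on the whole type, hence the restriction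
  to the carrier.
\<close>

definition comb_order :: "nat \<Rightarrow> comb_elem rel" where
  "comb_order n = (comb_covers n)\<^sup>* \<inter> comb n \<times> comb n"

text \<open>Closed form of the order on the carrier; see \<open>comb_order_iff\<close>.\<close>

fun comb_le :: "comb_elem \<Rightarrow> comb_elem \<Rightarrow> bool" where
  "comb_le (Leaf i) (Leaf j) \<longleftrightarrow> i = j"
| "comb_le (Leaf i) (Spine m) \<longleftrightarrow> False"
| "comb_le (Spine m) (Leaf i) \<longleftrightarrow> i \<le> m"
| "comb_le (Spine m) (Spine k) \<longleftrightarrow> k \<le> m"

lemma comb_le_refl: "comb_le x x"
  by (cases x) auto

lemma comb_le_trans: "comb_le x y \<Longrightarrow> comb_le y z \<Longrightarrow> comb_le x z"
  by (cases x; cases y; cases z) auto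

lemma comb_le_antisym: "comb_le x y \<Longrightarrow> comb_le y x \<Longrightarrow> x = y"
  by (cases x; cases y) auto

lemma comb_order_iff:
  "(x, y) \<in> comb_order n \<longleftrightarrow> x \<in> comb n \<and> y \<in> comb n \<and> comb_le x y"
proof -
  have 1: "comb_le x y" if "(x, y) \<in> (comb_covers n)\<^sup>*"
    using that
  proof (induction rule: rtrancl_induct)
    case (step y z)
    then have "comb_le y z" by (auto elim: comb_covers.cases)
    with step show ?case by (blast intro: comb_le_trans)
  qed (rule comb_le_refl)
  have spine: "(Spine m, Spine k) \<in> (comb_covers n)\<^sup>*" if "k \<le> m" "2 \<le> k" "m \<le> n + 1" for m k
    using that
  proof (induction m rule: dec_induct)
    case (step m)
    have "(Spine (Suc m), Spine m) \<in> comb_covers n"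
      using comb_covers.intros(1)[of "Suc m" n] step by simp
    with step show ?case by (auto intro: converse_rtrancl_into_rtrancl)
  qed auto
  have leaf: "(Spine m, Leaf i) \<in> (comb_covers n)\<^sup>*" if "1 \<le> i" "i \<le> m" "2 \<le> m" "m \<le> n + 1" for m i
  proof -
    have "(Spine (max i 2), Leaf i) \<in> comb_covers n"
    proof (cases "i \<ge> 3")
      case True
      then show ?thesis using that by (auto intro: comb_covers.intros)
    next
      case False
      then have i: "max i 2 = 2" "i = 1 \<or> i = 2" and n: "n \<ge> 1" using that by auto
      from i(2) show ?thesis
        unfolding i(1) using comb_covers.intros(3,4)[OF n] by blast
    qed
    with spine[of "max i 2" m] that show ?thesis
      by (auto intro: rtrancl_into_rtrancl)
  qed
  have 2: "(x, y) \<in> (comb_covers n)\<^sup>*" if "x \<in> comb n" "y \<in> comb n" "comb_le x y"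
    using that spine leaf by (cases x; cases y) (auto simp: comb_def)
  show ?thesis using 1 2 by (auto simp: comb_order_def)
qed

lemma finite_comb: "finite (comb n)"
  by (simp add: comb_def)

lemma card_comb: "card (comb n) = 2 * n + 1"
proof -
  have "card (comb n) = card (Leaf ` {1..n + 1}) + card (Spine ` {2..n + 1})"
    unfolding comb_def by (rule card_Un_disjoint) auto
  then show ?thesis by (simp add: card_image inj_on_def)
qed

lemma partial_order_comb: "partial_order_on (comb n) (comb_order n)"
  unfolding partial_order_on_def preorder_on_def
proof (intro conjI)
  show "comb_order n \<subseteq> comb n \<times> comb n"
    by (simp add: comb_order_def)
  show "refl_on (comb n) (comb_order n)"
    by (simp add: refl_on_def comb_order_iff comb_le_refl)
  show "trans (comb_order n)"
    by (rule transI) (metis comb_order_iff comb_le_trans)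
  show "antisym (comb_order n)"
    by (rule antisymI) (metis comb_order_iff comb_le_antisym)
qed

lemma leaves_above_Spine:
  assumes "m \<in> {2..n + 1}"
  shows "{i. (Spine m, Leaf i) \<in> comb_order n} = {1..m}"
  using assms by (auto simp: comb_order_iff comb_def)

end

theory Submission
  imports Defs
begin

text \<open>
  Removing the root \<open>b\<^sub>n\<^sub>+\<^sub>2\<close> and the leaf \<open>n + 2\<close> from the comb \<open>C\<^sub>n\<^sub>+\<^sub>1\<close> leaves \<open>C\<^sub>n\<close>, and the root
  lies below everything while the leaf is incomparable to all of \<open>C\<^sub>n\<close>. An antichain of \<open>C\<^sub>n\<^sub>+\<^sub>1\<close> is
  therefore either the singleton root or a pair \<open>(A, E)\<close> of an antichain of \<open>C\<^sub>n\<close> and a subset of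
  the new leaf. As long as the pair is not empty, rowmotion acts on it as rowmotion on \<open>A\<close> times
  the swap of \<open>{}\<close> and the new leaf (\<open>rho_comb_Suc\<close>). The empty antichain is sent to the root, and
  the root is sent to where the product map would have sent the empty pair (\<open>rho_root\<close>). So rowmotion
  on \<open>C\<^sub>n\<^sub>+\<^sub>1\<close> is the product of rowmotion on \<open>C\<^sub>n\<close> with an involution, with one extra point inserted
  into the orbit of the empty antichain.

  If that orbit has odd length \<open>N\<close> in \<open>C\<^sub>n\<close>, its product with the swap is a single cycle of length
  \<open>2N\<close>, and the inserted root makes it \<open>2N + 1\<close>, again odd. Starting from \<open>N = 3\<close> for \<open>C\<^sub>1\<close> this gives
  length \<open>2\<^sup>n\<^sup>+\<^sup>1 - 1\<close>. The cycle runs twice through the smaller one and contains the new leaf in every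
  second pair, so both statistics satisfy linear recurrences along it
  (\<open>sum_card_trajectory_Suc\<close>, \<open>sum_card_ideal_trajectory_Suc\<close>).

  An orbit of length two gives two orbits of length two in the product with the swap. Unwinding the
  recursion, these orbits consist of the sets of leaves that contain exactly one of the leaves 1 and 2
  above \<open>b\<^sub>2\<close>: the ideal of such a set contains the whole spine, so rowmotion complements the set
  within the leaves (\<open>rho_split\<close>). By induction along
  the product structure every other antichain is in the orbit of the empty one
  (\<open>antichain_split_or_trajectory\<close>).

  The statistics agree on all orbits of length two, and the remaining orbit has odd length, so
  homometry is immediate. Homomesy fails by comparing the two averages.
\<close>


section \<open>Rowmotion on a comb and on the next smaller comb\<close>

abbreviation rho :: "nat \<Rightarrow> comb_elem set \<Rightarrow> comb_elem set" where
  "rho n \<equiv> rowmotion (comb n) (comb_order n)"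

abbreviation ideal :: "nat \<Rightarrow> comb_elem set \<Rightarrow> comb_elem set" where
  "ideal n \<equiv> downset (comb n) (comb_order n)"

lemma comb_Suc: "comb (Suc n) = insert (Spine (n + 2)) (insert (Leaf (n + 2)) (comb n))"
  by (auto simp: comb_def image_iff)

lemma new_notin_comb: "Leaf (n + 2) \<notin> comb n" "Spine (n + 2) \<notin> comb n"
  by (auto simp: comb_def)

lemma ideal_eq:
  assumes "A \<subseteq> comb n"
  shows "ideal n A = {x \<in> comb n. \<exists>y\<in>A. comb_le x y}"
  using assms by (auto simp: downset_def comb_order_iff)

lemma rho_eq:
  assumes "A \<subseteq> comb n"
  shows "rho n A = {x \<in> comb n - ideal n A. \<forall>z\<in>comb n - ideal n A. comb_le z x \<longrightarrow> z = x}"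
  using assms by (auto simp: rowmotion_def minimals_def comb_order_iff)

lemma new_comparisons:
  assumes "x \<in> comb n"
  shows "comb_le (Spine (n + 2)) x" "\<not> comb_le x (Spine (n + 2))"
    "\<not> comb_le (Leaf (n + 2)) x" "\<not> comb_le x (Leaf (n + 2))"
  using assms by (auto simp: comb_def)

text \<open>
  The new leaf is incomparable to the smaller comb, so it contributes only itself. The root joins as
  soon as there is anything above it, which is why the empty antichain is excluded.
\<close>

lemma ideal_comb_Suc:
  assumes "A \<subseteq> comb n" "E \<subseteq> {Leaf (n + 2)}" "A \<union> E \<noteq> {}"
  shows "ideal (Suc n) (A \<union> E) = insert (Spine (n + 2)) (ideal n A \<union> E)"
proof (rule set_eqI)
  fix x
  have sub: "A \<union> E \<subseteq> comb (Suc n)" using assms by (auto simp: comb_Suc)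
  obtain y where y: "y \<in> A \<union> E" using assms(3) by blast
  then have root: "comb_le (Spine (n + 2)) y"
    using assms new_comparisons(1)[of y n] by (cases "y \<in> A") auto
  have noA: "\<not> comb_le (Leaf (n + 2)) z" if "z \<in> A" for z
    using that assms(1) new_comparisons(3) by blast
  have noE: "\<not> comb_le x z" if "x \<in> comb n" "z \<in> E" for z
    using that assms(2) new_comparisons(4) by blast
  have E: "(\<exists>z\<in>E. comb_le (Leaf (n + 2)) z) \<longleftrightarrow> Leaf (n + 2) \<in> E"
    using assms(2) comb_le_refl by blast
  consider "x = Spine (n + 2)" | "x = Leaf (n + 2)" | "x \<in> comb n" | "x \<notin> comb (Suc n)"
    by (auto simp: comb_Suc)
  then have "x \<in> {x \<in> comb (Suc n). \<exists>y\<in>A \<union> E. comb_le x y} \<longleftrightarrow>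
      x \<in> insert (Spine (n + 2)) ({x \<in> comb n. \<exists>y\<in>A. comb_le x y} \<union> E)"
  proof cases
    case 1
    then show ?thesis
      using y root by (auto simp: comb_Suc)
  next
    case 2
    then show ?thesis
      using noA E new_notin_comb[of n] by (auto simp: comb_Suc)
  next
    case 3
    then have "x \<notin> E" "x \<noteq> Spine (n + 2)"
      using assms(2) new_notin_comb[of n] by auto
    with 3 show ?thesis
      using noE by (auto simp: comb_Suc)
  next
    case 4
    then show ?thesis
      using assms(2) by (auto simp: comb_Suc)
  qed
  then show "x \<in> ideal (Suc n) (A \<union> E) \<longleftrightarrow> x \<in> insert (Spine (n + 2)) (ideal n A \<union> E)"
    unfolding ideal_eq[OF sub] ideal_eq[OF assms(1)] .
qed

lemma rho_subset: "rho n A \<subseteq> comb n"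
  using rowmotion_antichain[of "comb n" "comb_order n" A] by (simp add: antichains_def)

text \<open>
  Rowmotion depends only on the ideal. Stating the step for an arbitrary \<open>B\<close> with the right ideal
  covers both a pair, which generates such an ideal itself, and the root, whose ideal is the one that
  belongs to the empty pair.
\<close>

lemma rho_comb_Suc_if_ideal:
  assumes "A \<subseteq> comb n" "E \<subseteq> {Leaf (n + 2)}" "B \<subseteq> comb (Suc n)"
    and "ideal (Suc n) B = insert (Spine (n + 2)) (ideal n A \<union> E)"
  shows "rho (Suc n) B = rho n A \<union> ({Leaf (n + 2)} - E)"
proof -
  have "comb (Suc n) - ideal (Suc n) B = (comb n - ideal n A) \<union> ({Leaf (n + 2)} - E)"
    using assms new_notin_comb[of n] by (auto simp: comb_Suc downset_def)
  then show ?thesis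
    unfolding rho_eq[OF assms(3)] rho_eq[OF assms(1)]
    using new_comparisons[of _ n] by auto
qed

lemma rho_comb_Suc:
  assumes "A \<subseteq> comb n" "E \<subseteq> {Leaf (n + 2)}" "A \<union> E \<noteq> {}"
  shows "rho (Suc n) (A \<union> E) = rho n A \<union> ({Leaf (n + 2)} - E)"
  using assms by (intro rho_comb_Suc_if_ideal ideal_comb_Suc) (auto simp: comb_Suc)

lemma ideal_root: "ideal (Suc n) {Spine (n + 2)} = {Spine (n + 2)}"
  using new_comparisons(2,3)[of _ n]
  by (subst ideal_eq) (auto simp: comb_Suc comb_le_refl)

lemma ideal_empty: "ideal n {} = {}"
  by (simp add: downset_def)

text \<open>
  The product map would send the empty pair to this value; the root is inserted just before it.
\<close>

lemma rho_root: "rho (Suc n) {Spine (n + 2)} = insert (Leaf (n + 2)) (rho n {})"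
proof -
  have "rho (Suc n) {Spine (n + 2)} = rho n {} \<union> ({Leaf (n + 2)} - {})"
    by (rule rho_comb_Suc_if_ideal) (simp_all only: ideal_root ideal_empty, auto simp: comb_Suc)
  then show ?thesis by simp
qed

lemma rho_empty: "rho (Suc n) {} = {Spine (n + 2)}"
proof -
  have "rho (Suc n) {} = {x \<in> comb (Suc n). \<forall>z\<in>comb (Suc n). comb_le z x \<longrightarrow> z = x}"
    by (simp add: rho_eq ideal_empty)
  also have "\<dots> = {Spine (n + 2)}"
    using new_comparisons(1,2)[of _ n] new_notin_comb(2)[of n] by (auto simp: comb_Suc)
  finally show ?thesis .
qed

lemma comb_0: "comb 0 = {Leaf 1}"
  by (simp add: comb_def)

lemma rho_0: "rho 0 {} = {Leaf 1}" "rho 0 {Leaf 1} = {}"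
proof -
  show "rho 0 {} = {Leaf 1}"
    unfolding rho_eq[OF empty_subsetI] ideal_empty by (auto simp: comb_0)
  have "{Leaf 1} \<subseteq> comb 0" by (simp add: comb_0)
  from rho_eq[OF this] ideal_eq[OF this] show "rho 0 {Leaf 1} = {}"
    by (auto simp: comb_0)
qed


section \<open>Orbits as cycles of known length\<close>

lemma funpow_eq_self_iff_dvd:
  assumes "0 < N" "(f ^^ N) x = x" "\<And>k. 0 < k \<Longrightarrow> k < N \<Longrightarrow> (f ^^ k) x \<noteq> x"
  shows "(f ^^ k) x = x \<longleftrightarrow> N dvd k"
proof -
  have "(f ^^ k) x = (f ^^ (k mod N)) x"
    using assms(2) by (simp add: funpow_mod_eq)
  then show ?thesis
    using assms(3)[of "k mod N"] assms(1) by (auto simp: dvd_eq_mod_eq_0 intro!: Nat.gr0I)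
qed

text \<open>
  The summation starts at 1 rather than 0 because the orbit of the empty antichain is matched with
  that of the smaller comb after a shift by one step.
\<close>

lemma sum_orbit:
  fixes g :: "'a \<Rightarrow> nat"
  assumes "0 < N" and ret: "\<And>k. (f ^^ k) x = x \<longleftrightarrow> N dvd k"
  shows "sum g (orbit f x) = (\<Sum>k=1..N. g ((f ^^ k) x))"
proof -
  have N: "(f ^^ N) x = x" by (simp add: ret)
  \<comment> \<open>An equality of two points, pushed forward until the later one returns to \<open>x\<close>, would
    be a premature return.\<close>
  have ne: "(f ^^ i) x \<noteq> (f ^^ j) x" if "i < j" "j < N" for i j
  proof
    assume "(f ^^ i) x = (f ^^ j) x"
    then have "(f ^^ (N - j)) ((f ^^ i) x) = (f ^^ (N - j)) ((f ^^ j) x)" by simp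
    then have "(f ^^ (N - j + i)) x = (f ^^ (N - j + j)) x" by (simp only: funpow_add o_apply)
    then have "N dvd N - j + i" using that N ret by simp
    then show False using that by (auto dest: dvd_imp_le)
  qed
  have inj: "inj_on (\<lambda>k. (f ^^ k) x) {..<N}"
    by (rule inj_onI) (metis lessThan_iff linorder_neqE_nat ne)
  have "orbit f x = (\<lambda>k. (f ^^ k) x) ` {..<N}"
    using orbit_altdef_bounded[OF N assms(1)] by auto
  then have "sum g (orbit f x) = (\<Sum>k<N. g ((f ^^ k) x))"
    by (simp add: sum.reindex[OF inj])
  also have "\<dots> = (\<Sum>k<N. g ((f ^^ Suc k) x))"
    using sum.lessThan_Suc[of "\<lambda>k. g ((f ^^ k) x)" N]
      sum.lessThan_Suc_shift[of "\<lambda>k. g ((f ^^ k) x)" N] N by simp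
  finally show ?thesis by (simp add: sum.atLeast1_atMost_eq)
qed


section \<open>The orbit of the empty antichain\<close>

definition trajectory :: "nat \<Rightarrow> nat \<Rightarrow> comb_elem set" where
  "trajectory n k = (rho n ^^ k) {}"

definition period :: "nat \<Rightarrow> nat" where
  "period n = 2 ^ (n + 1) - 1"

abbreviation new_leaf :: "nat \<Rightarrow> nat \<Rightarrow> comb_elem set" where
  "new_leaf n k \<equiv> (if odd k then {Leaf (n + 2)} else {})"

lemma trajectory_0: "trajectory n 0 = {}"
  by (simp add: trajectory_def)

lemma trajectory_step: "trajectory n (Suc k) = rho n (trajectory n k)"
  by (simp add: trajectory_def)

lemma trajectory_subset: "trajectory n k \<subseteq> comb n"
  by (cases k) (simp_all add: trajectory_0 trajectory_step rho_subset)

lemma trajectory_1: "trajectory (Suc n) 1 = {Spine (n + 2)}"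
  by (simp add: trajectory_step trajectory_0 rho_empty)

lemma even_multiple_ge:
  fixes N k :: nat
  assumes "odd N" "N dvd k" "even k" "0 < k"
  shows "2 * N \<le> k"
proof -
  have "2 * N dvd k" using assms by (intro divides_mult) auto
  then show ?thesis using assms(4) by (rule dvd_imp_le)
qed

text \<open>
  The visit to the root delays the larger comb by one step; after it the product rule applies until
  the pair is empty again. That needs \<open>N\<close> to divide a positive even index, and as \<open>N\<close> is odd, the
  first such index is \<open>2N\<close>.
\<close>

lemma trajectory_Suc_if_odd_return:
  assumes "\<And>j. trajectory n j = {} \<longleftrightarrow> N dvd j" "odd N" "1 \<le> k" "k \<le> 2 * N"
  shows "trajectory (Suc n) (Suc k) = trajectory n k \<union> new_leaf n k"
  using assms(3,4)
proof (induction k rule: dec_induct)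
  case base
  then show ?case
    using trajectory_1[of n] rho_root[of n] by (simp add: trajectory_step trajectory_0)
next
  case (step k)
  have "trajectory n k \<union> new_leaf n k \<noteq> {}"
  proof
    assume "trajectory n k \<union> new_leaf n k = {}"
    then have "N dvd k" "even k" using assms(1)[of k] by (auto split: if_splits)
    then show False using even_multiple_ge[OF \<open>odd N\<close>, of k] step by simp
  qed
  then have "rho (Suc n) (trajectory n k \<union> new_leaf n k)
      = rho n (trajectory n k) \<union> ({Leaf (n + 2)} - new_leaf n k)"
    by (intro rho_comb_Suc trajectory_subset) auto
  then show ?case using step by (simp add: trajectory_step)
qed

lemma odd_period: "odd (period n)"
  by (simp add: period_def)

lemma period_1: "period 1 = 3"
  by (simp add: period_def)

lemma period_Suc: "period (Suc n) = Suc (2 * period n)"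
proof -
  have "(1::nat) \<le> 2 ^ n" by simp
  moreover have "period n = 2 * 2 ^ n - 1" "period (Suc n) = 4 * 2 ^ n - 1"
    by (simp_all add: period_def)
  ultimately show ?thesis by linarith
qed

lemma trajectory_1_2: "trajectory 1 2 = {Leaf 1, Leaf 2}"
  using trajectory_1[of 0] rho_root[of 0] trajectory_step[of 1 1] rho_0
  by (auto simp: numeral_2_eq_2)

lemma trajectory_1_3: "trajectory 1 3 = {}"
proof -
  have "rho 1 ({Leaf 1} \<union> {Leaf 2}) = {}"
    using rho_comb_Suc[of "{Leaf 1}" 0 "{Leaf 2}"] rho_0 by (simp add: comb_0 numeral_2_eq_2)
  then show ?thesis
    using trajectory_step[of 1 2] trajectory_1_2
    by (simp add: numeral_3_eq_3 numeral_2_eq_2 insert_commute)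
qed

text \<open>
  The induction carries exactly the hypothesis of \<open>trajectory_Suc_if_odd_return\<close>: by that lemma the
  empty pair first recurs at the least positive index that is even and divisible by the old period
  \<open>N\<close>, and the visit to the root makes the new period \<open>2N + 1\<close>. The induction starts at \<open>C\<^sub>1\<close> because
  on the single leaf \<open>C\<^sub>0\<close> the orbit of the empty antichain has even length 2.
\<close>

lemma trajectory_eq_empty_iff:
  assumes "n \<ge> 1"
  shows "trajectory n k = {} \<longleftrightarrow> period n dvd k"
  using assms
proof (induction n arbitrary: k rule: nat_induct_at_least)
  case base
  have "trajectory 1 j \<noteq> {}" if "0 < j" "j < 3" for j
  proof -
    have "j = 1 \<or> j = 2" using that by auto
    then show ?thesis using trajectory_1_2 trajectory_1[of 0] by auto
  qed
  then show ?case
    unfolding period_1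
    using funpow_eq_self_iff_dvd[of 3 "rho 1" "{}" k] trajectory_1_3 by (simp add: trajectory_def)
next
  case (Suc n)
  let ?N = "period n"
  note lift = trajectory_Suc_if_odd_return[OF Suc.IH odd_period]
  have pos: "0 < ?N" using odd_period[of n] by (rule odd_pos)
  have "trajectory (Suc n) (Suc (2 * ?N)) = {}"
    using lift[of "2 * ?N"] pos Suc.IH[of "2 * ?N"] by simp
  moreover have "trajectory (Suc n) j \<noteq> {}" if j: "0 < j" "j < Suc (2 * ?N)" for j
  proof (cases "j = 1")
    case True
    then show ?thesis using trajectory_1[of n] by simp
  next
    case False
    then obtain i where i: "j = Suc i" "1 \<le> i" "i < 2 * ?N"
      using j by (cases j) auto
    show ?thesis
    proof
      assume "trajectory (Suc n) j = {}"
      then have "trajectory n i = {}" "even i"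
        using lift[of i] i by (auto split: if_splits)
      then show False
        using even_multiple_ge[OF odd_period, of n i] Suc.IH[of i] i by simp
    qed
  qed
  ultimately show ?case
    unfolding period_Suc
    using funpow_eq_self_iff_dvd[of "Suc (2 * ?N)" "rho (Suc n)" "{}" k]
    by (simp add: trajectory_def)
qed

lemma trajectory_Suc:
  assumes "n \<ge> 1" "1 \<le> k" "k \<le> 2 * period n"
  shows "trajectory (Suc n) (Suc k) = trajectory n k \<union> new_leaf n k"
  using trajectory_Suc_if_odd_return[OF trajectory_eq_empty_iff[OF assms(1)] odd_period assms(2,3)] .

lemma period_pos: "0 < period n"
  using odd_period by (rule odd_pos)

lemma trajectory_period:
  assumes "n \<ge> 1"
  shows "trajectory n (period n + k) = trajectory n k"
proof -
  have "trajectory n (k + period n) = (rho n ^^ k) (trajectory n (period n))"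
    by (simp only: trajectory_def funpow_add o_apply)
  also have "trajectory n (period n) = {}"
    by (subst trajectory_eq_empty_iff[OF assms]) simp
  finally show ?thesis
    by (simp add: trajectory_def add.commute)
qed

text \<open>
  The representative is taken from \<open>1\<close> to the period, since the product description of the
  trajectory is not valid at index 0.
\<close>

lemma trajectory_representative:
  assumes "n \<ge> 1"
  obtains j where "trajectory n k = trajectory n j" "1 \<le> j" "j \<le> period n"
proof -
  have "trajectory n (period n) = {}"
    by (subst trajectory_eq_empty_iff[OF assms]) simp
  then have *: "trajectory n k = trajectory n (k mod period n)"
    "trajectory n (period n) = trajectory n 0"
    unfolding trajectory_def by (simp_all add: funpow_mod_eq)
  have "k mod period n < period n" using period_pos by (rule mod_less_divisor)
  then show ?thesis
    using that[of "k mod period n"] that[of "period n"] * period_pos[of n]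
    by (cases "k mod period n = 0") simp_all
qed


section \<open>The statistics along the orbit of the empty antichain\<close>

lemma sum_two_periods:
  fixes g :: "nat \<Rightarrow> nat"
  assumes "\<And>k. g (N + k) = g k"
  shows "(\<Sum>k=1..2 * N. g k) = 2 * (\<Sum>k=1..N. g k)"
proof -
  have split: "(\<Sum>k<N + M. g (Suc k)) = (\<Sum>k<N. g (Suc k)) + (\<Sum>k<M. g (Suc (N + k)))" for M
    by (induction M) simp_all
  have "(\<Sum>k=1..2 * N. g k) = (\<Sum>k<N + N. g (Suc k))"
    by (simp add: sum.atLeast1_atMost_eq mult_2)
  also have "\<dots> = (\<Sum>k<N. g (Suc k)) + (\<Sum>k<N. g (Suc (N + k)))"
    by (rule split)
  finally show ?thesis
    by (simp add: sum.atLeast1_atMost_eq assms flip: add_Suc_right)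
qed

lemma sum_odd_indicator: "(\<Sum>k=1..2 * N. of_bool (odd k)) = (N::nat)"
  by (induction N) (simp_all add: sum.atLeast1_atMost_eq)

lemma sum_period_Suc:
  fixes h :: "nat \<Rightarrow> nat"
  shows "(\<Sum>k=1..period (Suc n). h k) = h 1 + (\<Sum>k=1..2 * period n. h (Suc k))"
proof -
  have "(\<Sum>k=1..Suc M. h k) = h 1 + (\<Sum>k=1..M. h (Suc k))" for M
    unfolding One_nat_def sum.atLeast1_atMost_eq by (rule sum.lessThan_Suc_shift)
  then show ?thesis unfolding period_Suc .
qed

lemma finite_trajectory: "finite (trajectory n k)"
  using trajectory_subset finite_comb by (rule finite_subset)

text \<open>
  The cycle passes twice through the smaller one; the pairs at the \<open>N\<close> odd indices also contain
  the new leaf, and the last summand is the singleton root.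
\<close>

lemma sum_card_trajectory_Suc:
  assumes n: "n \<ge> 1"
  shows "(\<Sum>k=1..period (Suc n). card (trajectory (Suc n) k))
    = 2 * (\<Sum>k=1..period n. card (trajectory n k)) + period n + 1"
proof -
  have step: "card (trajectory (Suc n) (Suc k)) = card (trajectory n k) + of_bool (odd k)"
    if "k \<in> {1..2 * period n}" for k
  proof -
    have "Leaf (n + 2) \<notin> trajectory n k"
      using trajectory_subset new_notin_comb(1) by blast
    then show ?thesis
      using trajectory_Suc[OF n, of k] that finite_trajectory[of n k] by simp
  qed
  have root: "card (trajectory (Suc n) 1) = 1"
    using trajectory_1[of n] by simp
  have "(\<Sum>k=1..period (Suc n). card (trajectory (Suc n) k))
      = 1 + (\<Sum>k=1..2 * period n. card (trajectory n k) + of_bool (odd k))"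
    unfolding sum_period_Suc root by (intro arg_cong2[where f = "(+)"] refl sum.cong step)
  also have "\<dots> = 1 + (2 * (\<Sum>k=1..period n. card (trajectory n k)) + period n)"
    unfolding sum.distrib sum_odd_indicator
    using sum_two_periods[of "\<lambda>k. card (trajectory n k)" "period n"] trajectory_period[OF n]
    by simp
  finally show ?thesis by linarith
qed

lemma card_ideal_comb_Suc:
  assumes "A \<subseteq> comb n" "E \<subseteq> {Leaf (n + 2)}"
  shows "card (ideal (Suc n) (A \<union> E)) = card (ideal n A) + card E + of_bool (A \<union> E \<noteq> {})"
proof (cases "A \<union> E = {}")
  case False
  have sub: "ideal n A \<subseteq> comb n" by (auto simp: downset_def)
  have fin: "finite (ideal n A)" "finite E"
    using sub finite_comb assms(2) by (auto intro: finite_subset)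
  have "ideal n A \<inter> E = {}" "Spine (n + 2) \<notin> ideal n A \<union> E"
    using sub assms(2) new_notin_comb[of n] by auto
  then show ?thesis
    using False fin by (simp add: ideal_comb_Suc[OF assms False] card_Un_disjoint)
qed (simp add: ideal_empty)

text \<open>
  On top of the two passes through the smaller cycle, the new leaf lies in \<open>N\<close> of the ideals, and
  the root lies in all \<open>2N + 1\<close> of them except the empty one.
\<close>

lemma sum_card_ideal_trajectory_Suc:
  assumes n: "n \<ge> 1"
  shows "(\<Sum>k=1..period (Suc n). card (ideal (Suc n) (trajectory (Suc n) k)))
    = 2 * (\<Sum>k=1..period n. card (ideal n (trajectory n k))) + 3 * period n"
proof -
  let ?N = "period n"
  have ne: "trajectory n k \<union> new_leaf n k \<noteq> {} \<longleftrightarrow> k \<noteq> 2 * ?N" if "k \<in> {1..2 * ?N}" for k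
    using even_multiple_ge[OF odd_period, of n k] trajectory_eq_empty_iff[OF n, of k] that
    by auto
  have step: "card (ideal (Suc n) (trajectory (Suc n) (Suc k)))
      = card (ideal n (trajectory n k)) + of_bool (odd k) + of_bool (k \<noteq> 2 * ?N)"
    if "k \<in> {1..2 * ?N}" for k
    using trajectory_Suc[OF n, of k] that ne[OF that]
      card_ideal_comb_Suc[OF trajectory_subset, of "new_leaf n k" n k] by simp
  have "(\<Sum>k=1..2 * ?N. of_bool (k \<noteq> 2 * ?N)) = card ({1..2 * ?N} \<inter> {k. k \<noteq> 2 * ?N})"
    by (subst sum_of_bool_eq) simp_all
  also have "{1..2 * ?N} \<inter> {k. k \<noteq> 2 * ?N} = {1..<2 * ?N}" by auto
  finally have last: "(\<Sum>k=1..2 * ?N. of_bool (k \<noteq> 2 * ?N)) = 2 * ?N - 1" by simp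
  have root: "card (ideal (Suc n) (trajectory (Suc n) 1)) = 1"
    using trajectory_1[of n] ideal_root[of n] by simp
  have "(\<Sum>k=1..period (Suc n). card (ideal (Suc n) (trajectory (Suc n) k)))
      = 1 + (\<Sum>k=1..2 * ?N. card (ideal n (trajectory n k)) + of_bool (odd k) + of_bool (k \<noteq> 2 * ?N))"
    unfolding sum_period_Suc root by (intro arg_cong2[where f = "(+)"] refl sum.cong step)
  also have "\<dots> = 1 + (2 * (\<Sum>k=1..?N. card (ideal n (trajectory n k))) + ?N + (2 * ?N - 1))"
    unfolding sum.distrib sum_odd_indicator last
    using sum_two_periods[of "\<lambda>k. card (ideal n (trajectory n k))" ?N] trajectory_period[OF n]
    by simp
  finally show ?thesis
    using period_pos[of n] by linarith
qed

lemma sum_period_1: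
  fixes h :: "nat \<Rightarrow> nat"
  shows "(\<Sum>k=1..period 1. h k) = h 1 + h 2 + h 3"
proof -
  have "{1..period 1} = {1, 2, 3}" unfolding period_1 by auto
  then show ?thesis by simp
qed

lemma sum_card_trajectory:
  "(\<Sum>k=1..period (Suc m). card (trajectory (Suc m) k)) = (2 * m + 3) * 2 ^ m"
proof (induction m)
  case 0
  have "card (trajectory 1 1) = 1" using trajectory_1[of 0] by simp
  then show ?case
    unfolding One_nat_def[symmetric] sum_period_1 trajectory_1_2 trajectory_1_3 by simp
next
  case (Suc m)
  have "Suc m \<ge> 1" by simp
  moreover have "period (Suc m) + 1 = 2 ^ m * 4" by (simp add: period_def)
  ultimately show ?case
    using sum_card_trajectory_Suc[of "Suc m"] Suc.IH by (simp only: add.assoc) (simp add: algebra_simps)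
qed

lemma sum_card_ideal_trajectory:
  "(\<Sum>k=1..period (Suc m). card (ideal (Suc m) (trajectory (Suc m) k))) = 2 ^ m * (6 * m + 1) + 3"
proof (induction m)
  case 0
  have "card (ideal 1 (trajectory 1 1)) = 1"
    using trajectory_1[of 0] ideal_root[of 0] by simp
  moreover have "card (ideal 1 (trajectory 1 2)) = 3"
  proof -
    have sub: "{Leaf 1} \<subseteq> comb 0" by (simp add: comb_0)
    have "ideal 0 {Leaf 1} = {Leaf 1}"
      unfolding ideal_eq[OF sub] unfolding comb_0 by auto
    then have "ideal (Suc 0) ({Leaf 1} \<union> {Leaf 2}) = insert (Spine 2) ({Leaf 1} \<union> {Leaf 2})"
      using ideal_comb_Suc[OF sub, of "{Leaf 2}"] by (simp only: add_0) simp
    then show ?thesis unfolding trajectory_1_2 by (simp add: insert_commute)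
  qed
  moreover have "card (ideal 1 (trajectory 1 3)) = 0"
    unfolding trajectory_1_3 ideal_empty by simp
  ultimately show ?case
    unfolding One_nat_def[symmetric] sum_period_1 by simp
next
  case (Suc m)
  have "Suc m \<ge> 1" by simp
  moreover have "3 * period (Suc m) + 3 = 2 ^ m * 12"
    using period_pos[of "Suc m"] by (simp add: period_def)
  moreover have "2 ^ Suc m * (6 * Suc m + 1) = 2 * (2 ^ m * (6 * m + 1)) + (2::nat) ^ m * 12"
    by (simp add: algebra_simps)
  ultimately show ?case
    using sum_card_ideal_trajectory_Suc[of "Suc m"] Suc.IH by linarith
qed


section \<open>The orbits of size two\<close>

text \<open>
  The leaves 1 and 2 are the ones above the top spine element \<open>b\<^sub>2\<close>; a member of this family is
  split between them.
\<close>

definition split_antichains :: "nat \<Rightarrow> comb_elem set set" where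
  "split_antichains n = {Leaf ` I | I. I \<subseteq> {1..n + 1} \<and> (1 \<in> I \<longleftrightarrow> 2 \<notin> I)}"

text \<open>
  One of the leaves 1 and 2 is present, and both lie above the whole spine.
\<close>

lemma ideal_split:
  assumes "I \<subseteq> {1..n + 1}" "1 \<in> I \<longleftrightarrow> 2 \<notin> I"
  shows "ideal n (Leaf ` I) = Leaf ` I \<union> Spine ` {2..n + 1}"
proof -
  have sub: "Leaf ` I \<subseteq> comb n" using assms(1) by (auto simp: comb_def)
  obtain i where i: "i \<in> I" "i \<le> 2" using assms(2) by (cases "1 \<in> I") auto
  have "\<exists>y\<in>Leaf ` I. comb_le (Spine m) y" if "2 \<le> m" for m
    using that i by (intro bexI[of _ "Leaf i"]) auto
  moreover have "(\<exists>y\<in>Leaf ` I. comb_le (Leaf m) y) \<longleftrightarrow> m \<in> I" for m by auto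
  ultimately show ?thesis
    unfolding ideal_eq[OF sub] using assms(1) by (auto simp: comb_def simp del: comb_le.simps)
qed

lemma rho_split:
  assumes "I \<subseteq> {1..n + 1}" "1 \<in> I \<longleftrightarrow> 2 \<notin> I"
  shows "rho n (Leaf ` I) = Leaf ` ({1..n + 1} - I)"
proof -
  have sub: "Leaf ` I \<subseteq> comb n" using assms(1) by (auto simp: comb_def)
  have "comb n - ideal n (Leaf ` I) = Leaf ` ({1..n + 1} - I)"
    unfolding ideal_split[OF assms] by (auto simp: comb_def)
  then show ?thesis unfolding rho_eq[OF sub] by auto
qed

lemma orbit_split:
  assumes "n \<ge> 1" "I \<subseteq> {1..n + 1}" "1 \<in> I \<longleftrightarrow> 2 \<notin> I"
  shows "orbit (rho n) (Leaf ` I) = {Leaf ` I, Leaf ` ({1..n + 1} - I)}"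
proof -
  let ?c = "Leaf ` ({1..n + 1} - I)"
  have 1: "rho n (Leaf ` I) = ?c" by (rule rho_split[OF assms(2,3)])
  have "{1..n + 1} - ({1..n + 1} - I) = I" using assms(2) by blast
  then have 2: "rho n ?c = Leaf ` I"
    using rho_split[of "{1..n + 1} - I" n] assms by auto
  have "(rho n ^^ 2) (Leaf ` I) = Leaf ` I" by (simp only: numeral_2_eq_2 funpow.simps o_apply id_apply 1 2)
  then have "orbit (rho n) (Leaf ` I) = {(rho n ^^ k) (Leaf ` I) |k. k < 2}"
    by (rule orbit_altdef_bounded) simp
  also have "\<dots> = (\<lambda>k. (rho n ^^ k) (Leaf ` I)) ` {0, 1}"
    by (auto simp only: less_2_cases_iff image_iff)
  also have "\<dots> = {Leaf ` I, ?c}"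
    using 1 by simp
  finally show ?thesis .
qed


lemma orbit_split_statistics:
  assumes "n \<ge> 1" "A \<in> split_antichains n"
  shows "card (orbit (rho n) A) = 2" "chi (orbit (rho n) A) = n + 1"
    "chi_hat (comb n) (comb_order n) (orbit (rho n) A) = 3 * n + 1"
proof -
  obtain I where I: "A = Leaf ` I" "I \<subseteq> {1..n + 1}" "1 \<in> I \<longleftrightarrow> 2 \<notin> I"
    using assms(2) by (auto simp: split_antichains_def)
  let ?J = "{1..n + 1} - I"
  note orb = orbit_split[OF assms(1) I(2,3), folded I(1)]
  have J: "?J \<subseteq> {1..n + 1}" "1 \<in> ?J \<longleftrightarrow> 2 \<notin> ?J" using I(2,3) assms(1) by auto
  have "Leaf 1 \<in> Leaf ` I \<longleftrightarrow> Leaf 1 \<notin> Leaf ` ?J" by auto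
  then have ne: "A \<noteq> Leaf ` ?J" unfolding I(1) by blast
  have fin: "finite I" using I(2) by (rule finite_subset) simp
  have card_le: "card I \<le> n + 1" using card_mono[OF _ I(2)] by simp
  have leaves: "card (Leaf ` K) = card K" for K by (simp add: card_image inj_on_def)
  have cards: "card A + card (Leaf ` ?J) = n + 1"
    unfolding I(1) leaves using card_le I(2) fin by (simp add: card_Diff_subset)
  have ideal_card: "card (ideal n (Leaf ` K)) = card K + n"
    if "K \<subseteq> {1..n + 1}" "1 \<in> K \<longleftrightarrow> 2 \<notin> K" for K
  proof -
    have "finite K" using that(1) by (rule finite_subset) simp
    moreover have "Leaf ` K \<inter> Spine ` {2..n + 1} = {}" by auto
    ultimately show ?thesis
      unfolding ideal_split[OF that] by (simp add: card_Un_disjoint card_image inj_on_def)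
  qed
  show "card (orbit (rho n) A) = 2" unfolding orb using ne by simp
  show "chi (orbit (rho n) A) = n + 1" unfolding orb chi_def using ne cards by simp
  show "chi_hat (comb n) (comb_order n) (orbit (rho n) A) = 3 * n + 1"
    unfolding orb chi_hat_def
    using ne cards ideal_card[OF I(2,3)] ideal_card[OF J] by (simp add: I(1) leaves)
qed

text \<open>
  Exactly one of the two complementary sets in an orbit contains leaf 1, and it avoids leaf 2; such a
  set is determined by an arbitrary subset of the remaining \<open>n - 1\<close> leaves.
\<close>

lemma card_split_orbits:
  assumes "n \<ge> 1"
  shows "card (orbit (rho n) ` split_antichains n) = 2 ^ (n - 1)"
proof -
  let ?U = "{1..n + 1}"
  let ?f = "\<lambda>K. {Leaf ` insert 1 K, Leaf ` (?U - insert 1 K)}"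
  have f: "orbit (rho n) (Leaf ` insert 1 K) = ?f K" if "K \<subseteq> {3..n + 1}" for K
    using that assms by (intro orbit_split) auto
  have "orbit (rho n) ` split_antichains n = ?f ` Pow {3..n + 1}"
  proof (intro equalityI subsetI)
    fix X assume "X \<in> orbit (rho n) ` split_antichains n"
    then obtain I where I: "I \<subseteq> ?U" "1 \<in> I \<longleftrightarrow> 2 \<notin> I" "X = orbit (rho n) (Leaf ` I)"
      by (auto simp: split_antichains_def)
    have rep: "?f (J - {1}) = {Leaf ` J, Leaf ` (?U - J)}" "J - {1} \<in> Pow {3..n + 1}"
      if "1 \<in> J" "2 \<notin> J" "J \<subseteq> ?U" for J
    proof -
      have "insert 1 (J - {1}) = J" using that by auto
      then show "?f (J - {1}) = {Leaf ` J, Leaf ` (?U - J)}" by simp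
      show "J - {1} \<in> Pow {3..n + 1}"
      proof (intro PowI subsetI)
        fix x assume "x \<in> J - {1}"
        then have "x \<noteq> 1" "x \<noteq> 2" "1 \<le> x" "x \<le> n + 1" using that by auto
        then show "x \<in> {3..n + 1}" by simp
      qed
    qed
    have X: "X = {Leaf ` I, Leaf ` (?U - I)}"
      using orbit_split[OF assms I(1,2)] I(3) by simp
    show "X \<in> ?f ` Pow {3..n + 1}"
    proof (cases "1 \<in> I")
      case True
      then show ?thesis using rep[of I] I(1,2) X by (intro image_eqI[of _ _ "I - {1}"]) auto
    next
      case False
      have "?U - (?U - I) = I" using I(1) by blast
      then have "X = ?f (?U - I - {1})" "?U - I - {1} \<in> Pow {3..n + 1}"
        using rep[of "?U - I"] False I(2) X by (auto simp: insert_commute)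
      then show ?thesis by (rule image_eqI)
    qed
  next
    fix X assume "X \<in> ?f ` Pow {3..n + 1}"
    then obtain K where K: "K \<subseteq> {3..n + 1}" "X = ?f K" by auto
    have "Leaf ` insert 1 K \<in> split_antichains n"
      unfolding split_antichains_def using K(1) assms
      by (intro CollectI exI[of _ "insert 1 K"]) auto
    then show "X \<in> orbit (rho n) ` split_antichains n"
      using f[OF K(1)] K(2) by (metis image_eqI)
  qed
  moreover have "inj_on ?f (Pow {3..n + 1})"
  proof (rule inj_onI)
    fix K K' assume K: "K \<in> Pow {3..n + 1}" "K' \<in> Pow {3..n + 1}" "?f K = ?f K'"
    have "Leaf 1 \<in> Leaf ` insert 1 K" "Leaf 1 \<notin> Leaf ` (?U - insert 1 K')" by auto
    then have "Leaf ` insert 1 K \<noteq> Leaf ` (?U - insert 1 K')" by metis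
    then have "Leaf ` insert 1 K = Leaf ` insert 1 K'" using K(3) by (auto simp only: doubleton_eq_iff)
    moreover have "inj Leaf" by (simp add: inj_def)
    ultimately have "insert 1 K = insert 1 K'" by (simp only: inj_image_eq_iff)
    moreover have "1 \<notin> K" "1 \<notin> K'" using K by auto
    ultimately show "K = K'" by (metis insert_ident)
  qed
  ultimately show ?thesis
    by (simp add: card_image card_Pow)
qed


section \<open>Every antichain lies in one of these orbits\<close>

lemma antichain_comb_Suc_cases:
  assumes "A \<in> antichains (comb (Suc n)) (comb_order (Suc n))"
  obtains "A = {Spine (n + 2)}"
  | B E where "B \<in> antichains (comb n) (comb_order n)" "E \<subseteq> {Leaf (n + 2)}" "A = B \<union> E"
proof (cases "Spine (n + 2) \<in> A")
  case True
  have "x = Spine (n + 2)" if "x \<in> A" for x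
  proof -
    have x: "x \<in> comb (Suc n)" using that assms by (auto simp: antichains_def)
    have "comb_le (Spine (n + 2)) x" using x new_comparisons(1)[of x n] by (auto simp: comb_Suc)
    then have "(Spine (n + 2), x) \<in> comb_order (Suc n)"
      using x by (auto simp: comb_order_iff comb_Suc)
    then show ?thesis using True that assms by (auto simp: antichains_def)
  qed
  then show ?thesis using True that(1) by blast
next
  case False
  have "A \<inter> comb n \<in> antichains (comb n) (comb_order n)"
    using assms by (auto simp: antichains_def comb_order_iff comb_Suc)
  moreover have "A = (A \<inter> comb n) \<union> (A \<inter> {Leaf (n + 2)})"
    using False assms by (auto simp: antichains_def comb_Suc)
  ultimately show ?thesis using that(2) by blast
qed

lemma split_antichains_Suc:
  assumes "A \<in> split_antichains n" "E \<subseteq> {Leaf (n + 2)}" "n \<ge> 1"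
  shows "A \<union> E \<in> split_antichains (Suc n)"
proof -
  obtain I where I: "A = Leaf ` I" "I \<subseteq> {1..n + 1}" "1 \<in> I \<longleftrightarrow> 2 \<notin> I"
    using assms(1) by (auto simp: split_antichains_def)
  have "A \<union> E = Leaf ` (if E = {} then I else insert (n + 2) I)"
    using I(1) assms(2) by auto
  then show ?thesis
    unfolding split_antichains_def using I(2,3) assms(3)
    by (intro CollectI exI[of _ "if E = {} then I else insert (n + 2) I"]) auto
qed

text \<open>
  If \<open>A\<close> restricts to the \<open>k\<close>-th point of the smaller cycle, then both indices \<open>k\<close> and \<open>N + k\<close>
  give that restriction, and since \<open>N\<close> is odd exactly one of them has the parity that matches the
  presence of the new leaf in \<open>A\<close>.
\<close>

lemma antichain_split_or_trajectory:
  assumes "n \<ge> 1" "A \<in> antichains (comb n) (comb_order n)"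
  shows "A \<in> split_antichains n \<or> (\<exists>k. A = trajectory n k)"
  using assms
proof (induction n arbitrary: A rule: nat_induct_at_least)
  case base
  then have "A \<in> antichains (comb (Suc 0)) (comb_order (Suc 0))" by simp
  then show ?case
  proof (cases rule: antichain_comb_Suc_cases)
    case 1
    then show ?thesis using trajectory_1[of 0] by auto
  next
    case (2 B E)
    have "B = {} \<or> B = {Leaf 1}" "E = {} \<or> E = {Leaf 2}"
      using 2(1,2) by (auto simp: antichains_def comb_0 numeral_2_eq_2)
    then consider "A = trajectory 1 0" | "A = trajectory 1 2" | "A = Leaf ` {1}" | "A = Leaf ` {2}"
      unfolding 2(3) trajectory_0 trajectory_1_2 by auto
    then show ?thesis
    proof cases
      case 3
      then show ?thesis unfolding split_antichains_def by (intro disjI1 CollectI exI[of _ "{1}"]) auto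
    next
      case 4
      then show ?thesis unfolding split_antichains_def by (intro disjI1 CollectI exI[of _ "{2}"]) auto
    qed auto
  qed
next
  case (Suc n)
  let ?N = "period n"
  from Suc.prems show ?case
  proof (cases rule: antichain_comb_Suc_cases)
    case 1
    then show ?thesis using trajectory_1[of n] by auto
  next
    case (2 B E)
    from Suc.IH[OF 2(1)] show ?thesis
    proof
      assume "B \<in> split_antichains n"
      then show ?thesis
        using split_antichains_Suc 2(2,3) Suc.hyps by blast
    next
      assume "\<exists>k. B = trajectory n k"
      then obtain k where k: "B = trajectory n k" "1 \<le> k" "k \<le> ?N"
        using trajectory_representative[OF Suc.hyps] by metis
      define j where "j = (if odd k \<longleftrightarrow> E \<noteq> {} then k else ?N + k)"
      have "trajectory n j = B"
        using trajectory_period[OF Suc.hyps] k(1) by (simp add: j_def)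
      moreover have "odd j \<longleftrightarrow> E \<noteq> {}"
        using odd_period[of n] by (simp add: j_def)
      then have "new_leaf n j = E"
        using 2(2) by auto
      moreover have "1 \<le> j" "j \<le> 2 * ?N" using k by (auto simp: j_def)
      ultimately have "trajectory (Suc n) (Suc j) = A"
        using trajectory_Suc[OF Suc.hyps, of j] 2(3) by simp
      then show ?thesis by blast
    qed
  qed
qed

lemma orbit_trajectory:
  assumes "n \<ge> 1"
  shows "orbit (rho n) (trajectory n k) = orbit (rho n) {}"
proof -
  have ret: "(rho n ^^ period n) {} = {}"
    using trajectory_eq_empty_iff[OF assms, of "period n"] by (simp add: trajectory_def)
  have self: "{} \<in> orbit (rho n) {}"
    unfolding orbit_altdef using ret period_pos[of n] by (metis (mono_tags, lifting) mem_Collect_eq)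
  have "trajectory n k \<in> orbit (rho n) {}"
    unfolding trajectory_def using self by (rule funpow_in_orbit)
  then show ?thesis
    using orbit_cyclic_eq3[OF cyclic_on_singleI[OF self refl]] by blast
qed

lemma orbit_empty_statistics:
  assumes "n \<ge> 1"
  shows "card (orbit (rho n) {}) = period n"
    "chi (orbit (rho n) {}) = (2 * n + 1) * 2 ^ (n - 1)"
    "chi_hat (comb n) (comb_order n) (orbit (rho n) {}) = 2 ^ (n - 1) * (6 * n - 5) + 3"
proof -
  have sum_eq: "sum g (orbit (rho n) {}) = (\<Sum>k=1..period n. g (trajectory n k))" for g :: "_ \<Rightarrow> nat"
    unfolding trajectory_def
    by (rule sum_orbit[OF period_pos]) (rule trajectory_eq_empty_iff[OF assms, unfolded trajectory_def])
  obtain m where m: "n = Suc m" using assms by (cases n) auto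
  show "card (orbit (rho n) {}) = period n"
    using sum_eq[of "\<lambda>_. 1"] by simp
  show "chi (orbit (rho n) {}) = (2 * n + 1) * 2 ^ (n - 1)"
    unfolding chi_def sum_eq unfolding m sum_card_trajectory by (simp add: algebra_simps)
  show "chi_hat (comb n) (comb_order n) (orbit (rho n) {}) = 2 ^ (n - 1) * (6 * n - 5) + 3"
    unfolding chi_hat_def sum_eq unfolding m sum_card_ideal_trajectory by simp
qed

lemma rowmotion_orbits_comb:
  assumes "n \<ge> 1"
  shows "rowmotion_orbits (comb n) (comb_order n)
    = orbit (rho n) ` split_antichains n \<union> {orbit (rho n) {}}"
proof -
  have "split_antichains n \<subseteq> antichains (comb n) (comb_order n)"
    by (auto simp: split_antichains_def antichains_def comb_def comb_order_iff)
  moreover have "{} \<in> antichains (comb n) (comb_order n)"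
    by (simp add: antichains_def)
  ultimately show ?thesis
    unfolding rowmotion_orbits_def
    using antichain_split_or_trajectory[OF assms] orbit_trajectory[OF assms] by blast
qed

theorem theorem5p1:
  fixes n :: nat
  assumes "n \<ge> 1"
  shows "(\<exists>S L. S \<union> L = rowmotion_orbits (comb n) (comb_order n) \<and> S \<inter> L = {} \<and>
      (card S = 2 ^ (n - 1) \<and> card L = 1 \<and>
       (\<forall>X\<in>S. card X = 2) \<and>
       (\<forall>X\<in>L. card X = 2 ^ (n + 1) - 1)) \<and>
      ((\<forall>X\<in>S. chi X = n + 1) \<and>
       (\<forall>X\<in>L. chi X = (2 * n + 1) * 2 ^ (n - 1))) \<and>
      ((\<forall>X\<in>S. chi_hat (comb n) (comb_order n) X = 3 * n + 1) \<and>
       (\<forall>X\<in>L. chi_hat (comb n) (comb_order n) X = 2 ^ (n - 1) * (6 * n - 5) + 3))) \<and>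
    homometric (comb n) (comb_order n) chi \<and>
    (n \<ge> 2 \<longrightarrow> \<not> homomesic (comb n) (comb_order n) chi) \<and>
    homometric (comb n) (comb_order n) (chi_hat (comb n) (comb_order n)) \<and>
    \<not> homomesic (comb n) (comb_order n) (chi_hat (comb n) (comb_order n))"
proof -
  let ?S = "orbit (rho n) ` split_antichains n" and ?X = "orbit (rho n) {}"
  let ?hat = "chi_hat (comb n) (comb_order n)"
  let ?orbs = "rowmotion_orbits (comb n) (comb_order n)"
  note orbs = rowmotion_orbits_comb[OF assms]
  note S = orbit_split_statistics[OF assms]
  note X = orbit_empty_statistics[OF assms]
  have "card ?X \<noteq> 2" using odd_period[of n] unfolding X(1) by (metis even_numeral)
  then have sep: "card Y \<noteq> card ?X" if "Y \<in> ?S" for Y using that S(1) by auto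
  obtain Y where Y: "Y \<in> ?S"
    using card_split_orbits[OF assms] by (metis card.empty equals0I power_not_zero zero_neq_numeral)
  have not_homomesic: "\<not> homomesic (comb n) (comb_order n) st"
    if "st Y * period n \<noteq> st ?X * 2" for st
  proof
    assume "homomesic (comb n) (comb_order n) st"
    then have "real (st Y) / real (card Y) = real (st ?X) / real (card ?X)"
      using Y unfolding homomesic_def orbs by auto
    moreover have "card Y = 2" using Y S(1) by auto
    ultimately have "real (st Y) * real (period n) = real (st ?X) * real 2"
      using period_pos[of n] by (simp add: X(1) field_simps)
    then have "st Y * period n = st ?X * 2" by (simp only: of_nat_mult[symmetric] of_nat_eq_iff)
    with that show False ..
  qed
  obtain m where m: "n = Suc m" using assms by (cases n) auto
  have per: "period n + 1 = 4 * 2 ^ m" unfolding m by (simp add: period_def)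
  have pow: "m + 1 \<le> 2 ^ m" by (induction m) auto
  have pow_gt: "m + 2 < 2 * 2 ^ m" if "n \<ge> 2"
  proof -
    have "m \<ge> 1" using that m by simp
    then show ?thesis using pow by linarith
  qed
  show ?thesis
  proof (rule conjI, rule exI[of _ ?S], rule exI[of _ "{?X}"], goal_cases)
    case 1
    have "?S \<union> {?X} = ?orbs" by (simp add: orbs)
    moreover have "?S \<inter> {?X} = {}" using sep by blast
    moreover have "card ?X = 2 ^ (n + 1) - 1" using X(1) by (simp add: period_def)
    ultimately show ?case
      using card_split_orbits[OF assms] S X(2,3) by auto
  next
    case 2
    have *: "homometric (comb n) (comb_order n) st"
      if "\<And>Y Z. Y \<in> ?S \<Longrightarrow> Z \<in> ?S \<Longrightarrow> st Y = st Z" for st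
      unfolding homometric_def orbs using that sep by (metis Un_iff singletonD)
    have "homometric (comb n) (comb_order n) chi" by (rule *) (use S in auto)
    moreover have "homometric (comb n) (comb_order n) ?hat" by (rule *) (use S in auto)
    moreover have "\<not> homomesic (comb n) (comb_order n) chi" if "n \<ge> 2"
    proof (rule not_homomesic)
      \<comment> \<open>The averages agree only if \<open>m + 2 = 2 * 2 ^ m\<close>, that is \<open>n + 1 = 2 ^ n\<close>.\<close>
      have "(m + 2) * (period n + 1) = (2 * m + 3) * 2 ^ m * 2 + 2 * 2 ^ m"
        unfolding per by (simp add: algebra_simps)
      then have "(m + 2) * period n + (m + 2) = (2 * m + 3) * 2 ^ m * 2 + 2 * 2 ^ m"
        by simp
      then have "(m + 2) * period n \<noteq> (2 * m + 3) * 2 ^ m * 2"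
        using pow_gt[OF that] by linarith
      moreover have "chi Y = m + 2" using Y S(2) m by auto
      moreover have "chi ?X = (2 * m + 3) * 2 ^ m"
        using X(2) m by (simp add: algebra_simps)
      ultimately show "chi Y * period n \<noteq> chi ?X * 2" by simp
    qed
    moreover have "\<not> homomesic (comb n) (comb_order n) ?hat"
    proof (rule not_homomesic)
      \<comment> \<open>The averages agree only if \<open>14 * 2 ^ m = 3 * m + 10\<close>, and the left side is too large.\<close>
      have "(3 * m + 4) * (period n + 1) = 2 * (2 ^ m * (6 * m + 1)) + 14 * 2 ^ m"
        unfolding per by (simp add: algebra_simps)
      then have "(3 * m + 4) * period n + (3 * m + 4) = 2 * (2 ^ m * (6 * m + 1)) + 14 * 2 ^ m"
        by simp
      moreover have "x \<noteq> (a + 3) * 2" if "x + (3 * m + 4) = 2 * a + 14 * 2 ^ m" for x a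
        using that pow by arith
      ultimately have "(3 * m + 4) * period n \<noteq> (2 ^ m * (6 * m + 1) + 3) * 2"
        by blast
      moreover have "?hat Y = 3 * m + 4" "?hat ?X = 2 ^ m * (6 * m + 1) + 3"
        using Y S(3) X(3) m by auto
      ultimately show "?hat Y * period n \<noteq> ?hat ?X * 2" by simp
    qed
    ultimately show ?case by blast
  qed
qed

end
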